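(* For all integers $k\ge 3$, it holds that $g(3,k)\le \left\lfloor \frac{5}{4}k^2\right\rfloor$.
   Context: A state with $k$ vessels is a vector $A=(a_1,\dots,a_k)$ of non-negative integers (the contents of the vessels). A pouring step chooses two distinct vessels with contents $x$ and $y$, where $x\le y$, and replaces these contents by $2x$ (for the vessel that contained $x$) and $y-x$ (for the vessel that contained $y$); all other contents are unchanged. For an integer $p\ge 0$, a state is $p$-pourable if some sequence of at most $p$ pouring steps leads to a state in which at least one vessel has content $0$. For positive integers $N$ and $k\ge 3$, $g(N,k)$ is the smallest positive integer $n$ such that some state $A=(a_1,\dots,a_k)$ with $a_1+\cdots+a_k=n$ is not $(N-1)$-pourable. *)

theory Defs
  imports Complex_Main
begin

text \<open>A state with \<open>k\<close> vessels is a list of natural numbers of length \<open>k\<close>.\<close>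

inductive pour_step :: "nat list \<Rightarrow> nat list \<Rightarrow> bool" where
  "\<lbrakk>i < length A; j < length A; i \<noteq> j; A ! i \<le> A ! j\<rbrakk>
    \<Longrightarrow> pour_step A (A[i := 2 * A ! i, j := A ! j - A ! i])"

definition pourable :: "nat \<Rightarrow> nat list \<Rightarrow> bool" where
  "pourable p A \<longleftrightarrow> (\<exists>m\<le>p. \<exists>B. (pour_step ^^ m) A B \<and> 0 \<in> set B)"

text \<open>
  Only meant for \<open>N \<ge> 1\<close> and \<open>k \<ge> 3\<close>.  If no suitable \<open>n\<close> existed, \<open>LEAST\<close> would return an
  unspecified number, so an upper bound on \<open>g N k\<close> rests on the existence of such a state.
\<close>

definition g :: "nat \<Rightarrow> nat \<Rightarrow> nat" where
  "g N k = (LEAST n. 0 < n \<and> (\<exists>A. length A = k \<and> sum_list A = n \<and> \<not> pourable (N - 1) A))"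

end

theory Submission
  imports Defs
begin

text \<open>
  A distinct positive state needs at least two steps to produce a zero, and two steps suffice only
  if the first one produces two equal contents.  The residues \<open>\<plusminus>1\<close> modulo 5 form a sum-free set
  that contains neither doubles nor triples of its elements, so a state of distinct numbers from
  these residue classes stays distinct after the first step.  Taking the \<open>k\<close> smallest such
  numbers \<open>1, 4, 6, 9, \<dots>\<close> gives the sum \<open>\<lfloor>5 k\<^sup>2 / 4\<rfloor>\<close>.
\<close>

text \<open>The new contents are 2x and y - x, which vanish only if x = 0 or x = y.\<close>

lemma pour_step_zero_notin:
  assumes "pour_step A B" "distinct A" "0 \<notin> set A"
  shows "0 \<notin> set B"
  using assms
proof cases
  case (1 i j)
  then have "A ! i \<noteq> A ! j" "A ! i \<noteq> 0"
    using assms by (auto simp: nth_eq_iff_index_eq in_set_conv_nth)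
  then show ?thesis
    using 1 assms by (auto simp: in_set_conv_nth nth_list_update split: if_splits)
qed

text \<open>Adding two residues from {1, -1} modulo 5 gives 0, 2 or -2.\<close>

lemma add_mod5:
  fixes x z :: nat
  assumes "x mod 5 = 1 \<or> x mod 5 = 4" "z mod 5 = 1 \<or> z mod 5 = 4"
  shows "(x + z) mod 5 \<noteq> 1 \<and> (x + z) mod 5 \<noteq> 4"
  using assms mod_add_eq[of x 5 z] by auto

lemma pour_step_distinct:
  assumes step: "pour_step A B" and "distinct A"
    and mod5: "\<And>x. x \<in> set A \<Longrightarrow> x mod 5 = 1 \<or> x mod 5 = 4"
  shows "distinct B"
  using step
proof cases
  case (1 i j)
  define x y where "x = A ! i" and "y = A ! j"
  have B: "B ! l = (if l = j then y - x else if l = i then 2 * x else A ! l)"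
    if "l < length A" for l
    using 1 that by (auto simp: x_def y_def nth_list_update)
  have x: "x mod 5 = 1 \<or> x mod 5 = 4" and y: "y mod 5 = 1 \<or> y mod 5 = 4" and le: "x \<le> y"
    using 1 mod5 by (auto simp: x_def y_def)
  \<comment> \<open>Here 2x is the sum x + x, and y - x = z would make y the sum x + z;
    \<open>add_mod5\<close> excludes both.\<close>
  have "2 * x \<noteq> z" "y - x \<noteq> z" if "z \<in> set A" for z
    using add_mod5[OF x x] add_mod5[OF x mod5[OF that]] mod5[OF that] y le by (auto simp: mult_2)
  moreover have "2 * x \<noteq> y - x"
  proof
    assume "2 * x = y - x"
    then have "y = 3 * x"
      using le by simp
    moreover have "3 * x mod 5 = 3 * (x mod 5) mod 5"
      by (simp add: mod_mult_right_eq)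
    ultimately show False
      using x y by auto
  qed
  moreover have "A ! l \<noteq> A ! m" if "l < length A" "m < length A" "l \<noteq> m" for l m
    using that \<open>distinct A\<close> by (simp add: nth_eq_iff_index_eq)
  ultimately have "B ! l \<noteq> B ! m" if "l < length A" "m < length A" "l \<noteq> m" for l m
    using that by (auto simp: B) (metis nth_mem)+
  then show ?thesis
    using 1 by (simp add: distinct_conv_nth)
qed

lemma not_pourable_2:
  assumes "distinct A" and mod5: "\<And>x. x \<in> set A \<Longrightarrow> x mod 5 = 1 \<or> x mod 5 = 4"
  shows "\<not> pourable 2 A"
proof -
  have "0 \<notin> set A"
    using mod5 by force
  moreover have "0 \<notin> set B" if "pour_step A B" for B
    using pour_step_zero_notin that assms(1) calculation by blast
  \<comment> \<open>\<open>B\<close> may have left the residue classes, but it is still distinct and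
    free of zeros, which is what \<open>pour_step_zero_notin\<close> asks of it.\<close>
  moreover from this have "0 \<notin> set C" if "pour_step A B" "pour_step B C" for B C
    using pour_step_zero_notin pour_step_distinct assms that by blast
  moreover have "m = 0 \<or> m = 1 \<or> m = 2" if "m \<le> 2" for m :: nat
    using that by auto
  moreover have "pour_step ^^ 2 = pour_step OO pour_step"
    by (simp add: numeral_2_eq_2 eq_OO)
  ultimately show ?thesis
    unfolding pourable_def by (metis relcomppE relpowp_0_E relpowp_1)
qed

text \<open>The term at i = 2m is 5m + 1 and at i = 2m + 1 it is 5m + 4, so the terms list the
  numbers congruent to 1 or 4 modulo 5 in increasing order.\<close>

lemma sum_list_mod5_state: "sum_list (map (\<lambda>i. (5 * i + 3) div 2) [0..<k]) = 5 * k\<^sup>2 div 4"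
proof (induction k)
  case (Suc k)
  have "5 * k\<^sup>2 div 4 + (5 * k + 3) div 2 = 5 * (Suc k)\<^sup>2 div 4"
  proof (cases "even k")
    case True
    then obtain m where "k = 2 * m" ..
    \<comment> \<open>With n standing for the square of m, the identity becomes linear and
      \<open>presburger\<close> applies.\<close>
    moreover have "5 * n + (10 * m + 3) div 2 = (5 + (20 * m + 20 * n)) div 4" for n
      by presburger
    ultimately show ?thesis by (simp add: power2_eq_square)
  next
    case False
    then obtain m where "k = 2 * m + 1" by (rule oddE)
    then show ?thesis by (simp add: power2_eq_square)
  qed
  then show ?case using Suc by simp
qed simp

theorem theorem24:
  fixes k :: nat
  assumes "k \<ge> 3"
  shows "int (g 3 k) \<le> \<lfloor>5 / 4 * (real k)\<^sup>2\<rfloor>"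
proof -
  define A where "A = map (\<lambda>i. (5 * i + 3) div 2) [0..<k]"
  have "distinct A"
    unfolding A_def distinct_map by (auto intro!: inj_onI)
  moreover have "(10 * m + 3) div 2 = 5 * m + 1" for m :: nat
    by presburger
  then have "(5 * i + 3) div 2 mod 5 = 1 \<or> (5 * i + 3) div 2 mod 5 = 4" for i :: nat
    by (cases "even i") (auto elim!: evenE oddE)
  then have "x mod 5 = 1 \<or> x mod 5 = 4" if "x \<in> set A" for x
    using that unfolding A_def by auto
  ultimately have "\<not> pourable (3 - 1) A"
    using not_pourable_2 by simp
  moreover have "length A = k" "sum_list A = 5 * k\<^sup>2 div 4"
    by (simp_all add: A_def sum_list_mod5_state)
  \<comment> \<open>\<open>g\<close> ranges over positive totals, so the witness sum must be shown
    positive.\<close>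
  moreover have "0 < 5 * k\<^sup>2 div 4"
    using power_mono[OF assms, of 2] by simp
  ultimately have "g 3 k \<le> 5 * k\<^sup>2 div 4"
    unfolding g_def by (intro Least_le) blast
  also have "int (5 * k\<^sup>2 div 4) = \<lfloor>5 / 4 * (real k)\<^sup>2\<rfloor>"
    using floor_divide_of_nat_eq[of "5 * k\<^sup>2" 4, where 'a = real] by simp
  finally show ?thesis by simp
qed

end
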